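(* Let $(D,G_o)$ be a two-sender unicast index-coding problem with a fully participated interaction between its sub-digraphs $D_1,D_2,D_3$. Suppose that $f(D)$ contains all four arcs $(1,3),(3,1),(2,3),(3,2)$ and contains at most one of the arcs $(1,2),(2,1)$. Then $\beta(D,G_o)=\beta(D)$.
   Context: There are $N$ messages $\mathcal{M}=\{x_1,\dots,x_N\}$, $x_i\in\{0,1\}^t$, and $N$ receivers; receiver $r$ requests $x_r$ and knows $\{x_j: j\in N_D^+(r)\}$, where $D$ is a loopless digraph on $V(D)=\{1,\dots,N\}$ (the side-information digraph) and $N_D^+(r)$ is the out-neighborhood of $r$. Single sender: an index code is an encoding function of all messages into $\{0,1\}^p$ together with decoding functions by which every receiver $r$ recovers $x_r$, for all message realizations, from the codeword and its side information. $\beta_t(D)$ is the minimum of $p/t$ over index codes for $t$-bit messages, and $\beta(D)=\inf_t\beta_t(D)=\lim_{t\to\infty}\beta_t(D)$. Two senders: senders $S_1,S_2$ know $\mathcal{M}_1,\mathcal{M}_2$ with $\mathcal{M}_1\cup\mathcal{M}_2=\mathcal{M}$. A two-sender index code consists of encoding functions $\mathscr{F}_s:\{0,1\}^{|\mathcal{M}_s|t}\to\{0,1\}^{p_s}$, $s=1,2$ ($p_s\ge0$ an integer), and decoding functions by which every receiver $r$ recovers $x_r$, for all message realizations, from both sub-codewords and its side information. $\beta_t(D,G_o)$ is the minimum of $(p_1+p_2)/t$ over two-sender index codes for $t$-bit messages, and $\beta(D,G_o)=\inf_t\beta_t(D,G_o)=\lim_{t\to\infty}\beta_t(D,G_o)$.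 Here $G_o$ (the sender-constraint graph, with vertex set $V(D)$ and an edge $ij$ iff one of $x_i,x_j$ is in $\mathcal{M}_1\setminus\mathcal{M}_2$ and the other in $\mathcal{M}_2\setminus\mathcal{M}_1$) records the senders' message sets. Let $\mathcal{P}_1=\mathcal{M}_1\setminus\mathcal{M}_2$, $\mathcal{P}_2=\mathcal{M}_2\setminus\mathcal{M}_1$, $\mathcal{P}_3=\mathcal{M}_1\cap\mathcal{M}_2$. For $i\in\{1,2,3\}$, $D_i$ is the sub-digraph of $D$ induced by $\{j:x_j\in\mathcal{P}_i\}$. The digraph $f(D)$ has vertex set $\{1,2,3\}$, and $(i,j)$, $i\neq j$, is an arc of $f(D)$ iff there is an arc of $D$ from some vertex of $D_i$ to some vertex of $D_j$. The interaction is fully participated if, whenever $(i,j)$ is an arc of $f(D)$, every vertex of $D_i$ has arcs to all vertices of $D_j$. *)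

theory Defs
  imports Complex_Main "HOL-Library.FuncSet" "Graph_Theory.Graph_Theory"
begin

text \<open>The messages and the receivers are both indexed by the vertices of the side-information
  digraph. A realization of the \<open>t\<close>-bit messages with index set \<open>A\<close> is an extensional function,
  so restricting a realization to \<open>B\<close> retains exactly the messages indexed by \<open>B\<close>.\<close>

definition words :: "nat \<Rightarrow> bool list set" where
  "words p = {w. length w = p}"

definition realizations :: "'v set \<Rightarrow> nat \<Rightarrow> ('v \<Rightarrow> bool list) set" where
  "realizations A t = (\<Pi>\<^sub>E i\<in>A. words t)"

definition out_nbrs :: "('v, 'e) pre_digraph \<Rightarrow> 'v \<Rightarrow> 'v set" where
  "out_nbrs D r = {j. r \<rightarrow>\<^bsub>D\<^esub> j}"

definition index_code ::
  "('v, 'e) pre_digraph \<Rightarrow> nat \<Rightarrow> nat \<Rightarrow> (('v \<Rightarrow> bool list) \<Rightarrow> bool list) \<Rightarrow>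
   ('v \<Rightarrow> bool list \<times> ('v \<Rightarrow> bool list) \<Rightarrow> bool list) \<Rightarrow> bool" where
  "index_code D t p F G \<longleftrightarrow>
     F \<in> realizations (verts D) t \<rightarrow> words p \<and>
     (\<forall>r\<in>verts D. G r \<in> words p \<times> realizations (out_nbrs D r) t \<rightarrow> words t) \<and>
     (\<forall>x\<in>realizations (verts D) t. \<forall>r\<in>verts D. G r (F x, restrict x (out_nbrs D r)) = x r)"

text \<open>The minimum of \<open>p / t\<close> is attained at the least admissible \<open>p\<close>. For a finite vertex set an
  admissible \<open>p\<close> always exists, since all messages can be sent uncoded.\<close>

definition beta_t :: "('v, 'e) pre_digraph \<Rightarrow> nat \<Rightarrow> real" where
  "beta_t D t = real (LEAST p. \<exists>F G. index_code D t p F G) / real t"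

definition beta :: "('v, 'e) pre_digraph \<Rightarrow> real" where
  "beta D = (INF t\<in>{1..}. beta_t D t)"

text \<open>The sets \<open>M\<^sub>1\<close>, \<open>M\<^sub>2\<close> contain the indices of the messages known to the two senders. The
  sender-constraint graph merely records these sets, so they are used as arguments in its place.\<close>

definition two_sender_index_code ::
  "('v, 'e) pre_digraph \<Rightarrow> 'v set \<Rightarrow> 'v set \<Rightarrow> nat \<Rightarrow> nat \<Rightarrow> nat \<Rightarrow>
   (('v \<Rightarrow> bool list) \<Rightarrow> bool list) \<Rightarrow> (('v \<Rightarrow> bool list) \<Rightarrow> bool list) \<Rightarrow>
   ('v \<Rightarrow> bool list \<times> bool list \<times> ('v \<Rightarrow> bool list) \<Rightarrow> bool list) \<Rightarrow> bool" where
  "two_sender_index_code D M\<^sub>1 M\<^sub>2 t p\<^sub>1 p\<^sub>2 F\<^sub>1 F\<^sub>2 G \<longleftrightarrow>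
     F\<^sub>1 \<in> realizations M\<^sub>1 t \<rightarrow> words p\<^sub>1 \<and>
     F\<^sub>2 \<in> realizations M\<^sub>2 t \<rightarrow> words p\<^sub>2 \<and>
     (\<forall>r\<in>verts D. G r \<in> words p\<^sub>1 \<times> words p\<^sub>2 \<times> realizations (out_nbrs D r) t \<rightarrow> words t) \<and>
     (\<forall>x\<in>realizations (verts D) t. \<forall>r\<in>verts D.
        G r (F\<^sub>1 (restrict x M\<^sub>1), F\<^sub>2 (restrict x M\<^sub>2), restrict x (out_nbrs D r)) = x r)"

definition two_sender_beta_t ::
  "('v, 'e) pre_digraph \<Rightarrow> 'v set \<Rightarrow> 'v set \<Rightarrow> nat \<Rightarrow> real" where
  "two_sender_beta_t D M\<^sub>1 M\<^sub>2 t =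
     real (LEAST p. \<exists>p\<^sub>1 p\<^sub>2 F\<^sub>1 F\<^sub>2 G.
             p = p\<^sub>1 + p\<^sub>2 \<and> two_sender_index_code D M\<^sub>1 M\<^sub>2 t p\<^sub>1 p\<^sub>2 F\<^sub>1 F\<^sub>2 G) / real t"

definition two_sender_beta :: "('v, 'e) pre_digraph \<Rightarrow> 'v set \<Rightarrow> 'v set \<Rightarrow> real" where
  "two_sender_beta D M\<^sub>1 M\<^sub>2 = (INF t\<in>{1..}. two_sender_beta_t D M\<^sub>1 M\<^sub>2 t)"

text \<open>Only \<open>i \<in> {1, 2, 3}\<close> is meaningful in the next two definitions.\<close>

definition message_part :: "'v set \<Rightarrow> 'v set \<Rightarrow> nat \<Rightarrow> 'v set" where
  "message_part M\<^sub>1 M\<^sub>2 i =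
     (if i = 1 then M\<^sub>1 - M\<^sub>2 else if i = 2 then M\<^sub>2 - M\<^sub>1 else if i = 3 then M\<^sub>1 \<inter> M\<^sub>2 else {})"

definition sub_digraph ::
  "('v, 'e) pre_digraph \<Rightarrow> 'v set \<Rightarrow> 'v set \<Rightarrow> nat \<Rightarrow> ('v, 'e) pre_digraph" where
  "sub_digraph D M\<^sub>1 M\<^sub>2 i = D \<restriction> message_part M\<^sub>1 M\<^sub>2 i"

definition interaction_digraph ::
  "('v, 'e) pre_digraph \<Rightarrow> 'v set \<Rightarrow> 'v set \<Rightarrow> (nat, nat \<times> nat) pre_digraph" where
  "interaction_digraph D M\<^sub>1 M\<^sub>2 =
     \<lparr> verts = {1, 2, 3},
       arcs = {(i, j). i \<in> {1, 2, 3} \<and> j \<in> {1, 2, 3} \<and> i \<noteq> j \<and>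
                 (\<exists>u\<in>verts (sub_digraph D M\<^sub>1 M\<^sub>2 i). \<exists>v\<in>verts (sub_digraph D M\<^sub>1 M\<^sub>2 j). u \<rightarrow>\<^bsub>D\<^esub> v)},
       tail = fst,
       head = snd \<rparr>"

definition fully_participated :: "('v, 'e) pre_digraph \<Rightarrow> 'v set \<Rightarrow> 'v set \<Rightarrow> bool" where
  "fully_participated D M\<^sub>1 M\<^sub>2 \<longleftrightarrow>
     (\<forall>i j. (i, j) \<in> arcs (interaction_digraph D M\<^sub>1 M\<^sub>2) \<longrightarrow>
        (\<forall>u\<in>verts (sub_digraph D M\<^sub>1 M\<^sub>2 i). \<forall>v\<in>verts (sub_digraph D M\<^sub>1 M\<^sub>2 j). u \<rightarrow>\<^bsub>D\<^esub> v))"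

end

theory Submission
  imports Defs "HOL-Real_Asymp.Real_Asymp"
begin

text \<open>Call two realizations confusable if some receiver has equal side information in both but
  requests different messages. Codes are colourings of the confusion graph, so the size of a code
  for \<open>A\<close> is governed by the maximal size of an independent set: that graph is a Cayley graph, hence
  it is covered by few translates of a maximum independent set, at the cost of a factor
  logarithmic in the number of vertices. If no receiver in \<open>B\<close> knows a message
  of \<open>A\<close>, an independent set for \<open>A \<union> B\<close> has an independent projection to \<open>B\<close> with independent
  fibres over \<open>A\<close>. Therefore optimal code lengths are superadditive up to \<open>O(log t)\<close>, which
  disappears after division by \<open>t\<close>. Finally the senders can merge codes for the parts 1, 2 and 3 of
  lengths \<open>p\<^sub>1\<close>, \<open>p\<^sub>2\<close>, \<open>p\<^sub>3\<close> into a code of length \<open>max (p\<^sub>1 + p\<^sub>2) p\<^sub>3\<close>, by adding disjoint pieces of the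
  codeword for part 3 to the other two codewords.\<close>

section \<open>Words\<close>

definition xor :: "bool list \<Rightarrow> bool list \<Rightarrow> bool list" where
  "xor = map2 (\<noteq>)"

lemma length_xor [simp]: "length (xor xs ys) = min (length xs) (length ys)"
  by (simp add: xor_def)

lemma xor_xor_cancel: "length xs = length ys \<Longrightarrow> xor (xor xs ys) ys = xs"
  by (induction xs ys rule: list_induct2) (auto simp: xor_def)

lemma xor_commute: "xor xs ys = xor ys xs"
proof (induction xs arbitrary: ys)
  case (Cons a xs)
  then show ?case by (cases ys) (auto simp: xor_def)
qed (simp add: xor_def)

lemma xor_right_cancel:
  assumes "length xs = length zs" "length ys = length zs" "xor xs zs = xor ys zs"
  shows "xs = ys"
  using assms xor_xor_cancel by metis

lemma xor_eq_iff:
  assumes "length xs = n" "length ys = n" "length zs = n"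
  shows "xor zs xs = xor zs ys \<longleftrightarrow> xs = ys"
  using assms xor_right_cancel xor_commute by metis

lemma card_words: "card (words p) = 2 ^ p"
  using card_lists_length_eq[of "UNIV :: bool set" p] by (simp add: words_def)

lemma finite_words [simp]: "finite (words p)"
  using finite_lists_length_eq[of "UNIV :: bool set" p] by (simp add: words_def)

lemma finite_realizations [simp]: "finite A \<Longrightarrow> finite (realizations A t)"
  by (simp add: realizations_def finite_PiE)

lemma card_realizations: "finite A \<Longrightarrow> card (realizations A t) = 2 ^ (t * card A)"
  by (simp add: realizations_def card_PiE card_words power_mult)

lemma restrict_realizations: "x \<in> realizations A t \<Longrightarrow> B \<subseteq> A \<Longrightarrow> restrict x B \<in> realizations B t"
  by (auto simp: realizations_def)

lemma length_realizations: "x \<in> realizations A t \<Longrightarrow> a \<in> A \<Longrightarrow> length (x a) = t"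
  by (auto simp: realizations_def words_def)

lemma length_code: "F \<in> X \<rightarrow> words p \<Longrightarrow> x \<in> X \<Longrightarrow> length (F x) = p"
  by (auto simp: words_def)

section \<open>Codes as colourings of the confusion graph\<close>

text \<open>Side information is given by \<open>K\<close> on all vertices and cut down to
  \<open>A\<close>, so one and the same \<open>K\<close> serves every induced sub-digraph.\<close>

definition confusable :: "('v \<Rightarrow> 'v set) \<Rightarrow> 'v set \<Rightarrow> ('v \<Rightarrow> 'b) \<Rightarrow> ('v \<Rightarrow> 'b) \<Rightarrow> bool" where
  "confusable K A x y \<longleftrightarrow> (\<exists>r\<in>A. x r \<noteq> y r \<and> (\<forall>j\<in>K r \<inter> A. x j = y j))"

text \<open>Decoders are eliminated here: by \<open>decoders_exist_iff\<close> they exist precisely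
  when the codeword is a proper colour, so that only the encoder has to be constructed
  later.\<close>

definition valid_code ::
  "('v \<Rightarrow> 'v set) \<Rightarrow> 'v set \<Rightarrow> nat \<Rightarrow> nat \<Rightarrow> (('v \<Rightarrow> bool list) \<Rightarrow> bool list) \<Rightarrow> bool" where
  "valid_code K A t p F \<longleftrightarrow> F \<in> realizations A t \<rightarrow> words p \<and>
     (\<forall>x\<in>realizations A t. \<forall>y\<in>realizations A t. F x = F y \<longrightarrow> \<not> confusable K A x y)"

definition code_length :: "('v \<Rightarrow> 'v set) \<Rightarrow> 'v set \<Rightarrow> nat \<Rightarrow> nat" where
  "code_length K A t = (LEAST p. \<exists>F. valid_code K A t p F)"

definition indep :: "('v \<Rightarrow> 'v set) \<Rightarrow> 'v set \<Rightarrow> nat \<Rightarrow> ('v \<Rightarrow> bool list) set \<Rightarrow> bool" where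
  "indep K A t S \<longleftrightarrow> S \<subseteq> realizations A t \<and> (\<forall>x\<in>S. \<forall>y\<in>S. \<not> confusable K A x y)"

text \<open>A map factors through \<open>h\<close> precisely when it is constant on the fibres of
  \<open>h\<close>. The value \<open>w\<close> serves arguments outside the image of
  \<open>h\<close>, so that the decoder stays \<open>W\<close>-valued on all of
  \<open>C\<close>.\<close>

lemma decoder_exists_iff:
  assumes "h \<in> X \<rightarrow> C" "v \<in> X \<rightarrow> W" "w \<in> W"
  shows "(\<exists>g. g \<in> C \<rightarrow> W \<and> (\<forall>x\<in>X. g (h x) = v x)) \<longleftrightarrow>
         (\<forall>x\<in>X. \<forall>y\<in>X. h x = h y \<longrightarrow> v x = v y)"
proof
  assume R: "\<forall>x\<in>X. \<forall>y\<in>X. h x = h y \<longrightarrow> v x = v y"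
  define g where "g c = (if \<exists>x\<in>X. h x = c then v (SOME x. x \<in> X \<and> h x = c) else w)" for c
  have *: "g (h x) = v x" if "x \<in> X" for x
  proof -
    have "(SOME y. y \<in> X \<and> h y = h x) \<in> X \<and> h (SOME y. y \<in> X \<and> h y = h x) = h x"
      by (rule someI[of _ x]) (use that in auto)
    then have "v (SOME y. y \<in> X \<and> h y = h x) = v x"
      using R that by blast
    then show ?thesis using that by (auto simp: g_def)
  qed
  have "g c \<in> W" for c
  proof (cases "\<exists>x\<in>X. h x = c")
    case True
    then show ?thesis using * assms(2) by auto
  qed (use assms(3) in \<open>simp add: g_def\<close>)
  then show "\<exists>g. g \<in> C \<rightarrow> W \<and> (\<forall>x\<in>X. g (h x) = v x)"
    using * by blast
qed metis

lemma restrict_eq_iff: "restrict x B = restrict y B \<longleftrightarrow> (\<forall>j\<in>B. x j = y j)"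
  by (metis restrict_apply' restrict_ext)

text \<open>Receivers decode independently, so choice reduces the claim to one receiver, whose
  observation is the pair of codeword and side information. The codeword set \<open>C\<close> is
  left open in order to cover both a single codeword and a pair of sub-codewords.\<close>

lemma decoders_exist_iff:
  assumes h: "h \<in> realizations A t \<rightarrow> C"
    and K: "\<And>r. r \<in> A \<Longrightarrow> K r \<subseteq> A"
  shows "(\<exists>G. (\<forall>r\<in>A. G r \<in> C \<times> realizations (K r) t \<rightarrow> words t) \<and>
            (\<forall>x\<in>realizations A t. \<forall>r\<in>A. G r (h x, restrict x (K r)) = x r)) \<longleftrightarrow>
         (\<forall>x\<in>realizations A t. \<forall>y\<in>realizations A t. h x = h y \<longrightarrow> \<not> confusable K A x y)"
    (is "?L \<longleftrightarrow> ?R")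
proof -
  define Q where "Q r g \<longleftrightarrow> g \<in> C \<times> realizations (K r) t \<rightarrow> words t \<and>
            (\<forall>x\<in>realizations A t. g (h x, restrict x (K r)) = x r)" for r g
  have "?L \<longleftrightarrow> (\<exists>G. \<forall>r\<in>A. Q r (G r))"
    unfolding Q_def by (intro arg_cong[of _ _ Ex] ext) blast
  also have "\<dots> \<longleftrightarrow> (\<forall>r\<in>A. \<exists>g. Q r g)"
    by (rule bchoice_iff[symmetric])
  also have "\<dots> \<longleftrightarrow> (\<forall>r\<in>A. \<forall>x\<in>realizations A t. \<forall>y\<in>realizations A t.
      (h x, restrict x (K r)) = (h y, restrict y (K r)) \<longrightarrow> x r = y r)"
    unfolding Q_def
  proof (rule ball_cong[OF refl], rule decoder_exists_iff)
    fix r assume r: "r \<in> A"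
    show "(\<lambda>x. (h x, restrict x (K r))) \<in> realizations A t \<rightarrow> C \<times> realizations (K r) t"
      using h K[OF r] restrict_realizations by blast
    show "(\<lambda>x. x r) \<in> realizations A t \<rightarrow> words t"
      using r by (auto simp: realizations_def)
    show "replicate t False \<in> words t" by (simp add: words_def)
  qed
  also have "\<dots> \<longleftrightarrow> ?R"
  proof -
    have "restrict x (K r) = restrict y (K r) \<longleftrightarrow> (\<forall>j\<in>K r \<inter> A. x j = y j)" if "r \<in> A"
      for r and x y :: "'a \<Rightarrow> bool list"
      using K[OF that] by (simp add: restrict_eq_iff Int_absorb2)
    then show ?thesis unfolding confusable_def prod.inject by blast
  qed
  finally show ?thesis .
qed

lemma index_code_iff_valid_code:
  assumes "wf_digraph D"
  shows "(\<exists>G. index_code D t p F G) \<longleftrightarrow> valid_code (out_nbrs D) (verts D) t p F"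
proof (cases "F \<in> realizations (verts D) t \<rightarrow> words p")
  case True
  have "out_nbrs D r \<subseteq> verts D" for r
    using wf_digraph.adj_in_verts[OF assms] by (auto simp: out_nbrs_def)
  with decoders_exist_iff[OF True, of "out_nbrs D"] True show ?thesis
    unfolding index_code_def valid_code_def by simp
qed (simp add: index_code_def valid_code_def)

text \<open>The two sub-codewords are read as one codeword in
  \<open>words p\<^sub>1 \<times> words p\<^sub>2\<close>; beyond \<open>decoders_exist_iff\<close>
  only a reassociation of tuples is required.\<close>

lemma two_sender_index_code_iff:
  assumes "wf_digraph D" "M\<^sub>1 \<union> M\<^sub>2 = verts D"
  shows "(\<exists>G. two_sender_index_code D M\<^sub>1 M\<^sub>2 t p\<^sub>1 p\<^sub>2 F\<^sub>1 F\<^sub>2 G) \<longleftrightarrow>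
    F\<^sub>1 \<in> realizations M\<^sub>1 t \<rightarrow> words p\<^sub>1 \<and> F\<^sub>2 \<in> realizations M\<^sub>2 t \<rightarrow> words p\<^sub>2 \<and>
    (\<forall>x\<in>realizations (verts D) t. \<forall>y\<in>realizations (verts D) t.
       F\<^sub>1 (restrict x M\<^sub>1) = F\<^sub>1 (restrict y M\<^sub>1) \<longrightarrow> F\<^sub>2 (restrict x M\<^sub>2) = F\<^sub>2 (restrict y M\<^sub>2) \<longrightarrow>
       \<not> confusable (out_nbrs D) (verts D) x y)"
proof (cases "F\<^sub>1 \<in> realizations M\<^sub>1 t \<rightarrow> words p\<^sub>1 \<and> F\<^sub>2 \<in> realizations M\<^sub>2 t \<rightarrow> words p\<^sub>2")
  case True
  let ?X = "realizations (verts D) t"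
  let ?h = "\<lambda>x. (F\<^sub>1 (restrict x M\<^sub>1), F\<^sub>2 (restrict x M\<^sub>2))"
  have h: "?h \<in> ?X \<rightarrow> words p\<^sub>1 \<times> words p\<^sub>2"
    using True restrict_realizations[of _ "verts D" t] assms(2) by blast
  have K: "out_nbrs D r \<subseteq> verts D" for r
    using wf_digraph.adj_in_verts[OF assms(1)] by (auto simp: out_nbrs_def)
  let ?P = "\<lambda>G. (\<forall>r\<in>verts D. G r \<in> (words p\<^sub>1 \<times> words p\<^sub>2) \<times> realizations (out_nbrs D r) t \<rightarrow> words t) \<and>
            (\<forall>x\<in>?X. \<forall>r\<in>verts D. G r (?h x, restrict x (out_nbrs D r)) = x r)"
  have "(\<exists>G. two_sender_index_code D M\<^sub>1 M\<^sub>2 t p\<^sub>1 p\<^sub>2 F\<^sub>1 F\<^sub>2 G) \<longleftrightarrow> (\<exists>G. ?P G)"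
  proof
    assume "\<exists>G. two_sender_index_code D M\<^sub>1 M\<^sub>2 t p\<^sub>1 p\<^sub>2 F\<^sub>1 F\<^sub>2 G"
    then obtain G where G: "two_sender_index_code D M\<^sub>1 M\<^sub>2 t p\<^sub>1 p\<^sub>2 F\<^sub>1 F\<^sub>2 G" by blast
    have "?P (\<lambda>r ((a, b), c). G r (a, b, c))"
      using G by (auto simp: two_sender_index_code_def)
    then show "\<exists>G. ?P G" by (rule exI[of ?P])
  next
    assume "\<exists>G. ?P G"
    then obtain G where G: "?P G" by blast
    have "two_sender_index_code D M\<^sub>1 M\<^sub>2 t p\<^sub>1 p\<^sub>2 F\<^sub>1 F\<^sub>2 (\<lambda>r (a, b, c). G r ((a, b), c))"
      using G True by (auto simp: two_sender_index_code_def)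
    then show "\<exists>G. two_sender_index_code D M\<^sub>1 M\<^sub>2 t p\<^sub>1 p\<^sub>2 F\<^sub>1 F\<^sub>2 G" by blast
  qed
  also have "\<dots> \<longleftrightarrow> (\<forall>x\<in>?X. \<forall>y\<in>?X. ?h x = ?h y \<longrightarrow> \<not> confusable (out_nbrs D) (verts D) x y)"
    using K by (intro decoders_exist_iff[OF h])
  finally show ?thesis using True unfolding prod.inject by blast
qed (auto simp: two_sender_index_code_def)

section \<open>Code lengths\<close>

text \<open>Sending everything uncoded works because confusable realizations are distinct. This
  makes the \<open>LEAST\<close> in \<open>code_length\<close> meaningful.\<close>

lemma valid_code_exists:
  assumes "finite A"
  shows "\<exists>p F. valid_code K A t p F"
proof -
  define p where "p = t * card A"
  have "card (realizations A t) = card (words p)"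
    by (simp add: card_realizations assms card_words p_def)
  then obtain F where F: "bij_betw F (realizations A t) (words p)"
    using finite_same_card_bij assms by (metis finite_realizations finite_words)
  then have "valid_code K A t p F"
    unfolding valid_code_def confusable_def by (auto simp: bij_betw_def inj_on_def)
  then show ?thesis by blast
qed

lemma code_length_valid:
  assumes "finite A"
  obtains F where "valid_code K A t (code_length K A t) F"
  using LeastI_ex[OF valid_code_exists[OF assms, of K t]] unfolding code_length_def by blast

lemma code_length_le: "valid_code K A t p F \<Longrightarrow> code_length K A t \<le> p"
  unfolding code_length_def by (rule Least_le) blast

lemma valid_code_pad:
  assumes "valid_code K A t p F" "p \<le> q"
  shows "valid_code K A t q (\<lambda>x. F x @ replicate (q - p) False)"
  using assms unfolding valid_code_def by (auto simp: words_def Pi_iff)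

text \<open>A code for \<open>B\<close> is used with all messages outside \<open>A\<close> frozen to
  the zero word. Frozen messages agree in any two realizations, so confusable pairs stay
  confusable.\<close>

lemma code_length_subset:
  assumes "finite B" "A \<subseteq> B"
  shows "code_length K A t \<le> code_length K B t"
proof -
  obtain F where F: "valid_code K B t (code_length K B t) F"
    using code_length_valid assms(1) by blast
  define e where "e x = (\<lambda>b\<in>B. if b \<in> A then x b else replicate t False)" for x
  have e: "e x \<in> realizations B t" if "x \<in> realizations A t" for x
    using that by (auto simp: e_def realizations_def words_def)
  have c: "confusable K B (e x) (e y)" if "confusable K A x y" for x y
    using that assms(2) unfolding confusable_def e_def by force
  have "valid_code K A t (code_length K B t) (\<lambda>x. F (e x))"
    using F e c unfolding valid_code_def by blast
  then show ?thesis by (rule code_length_le)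
qed

text \<open>Each message is cut into its first \<open>s\<close> and last \<open>t\<close> bits, and
  the two layers are encoded separately. Distinct messages differ in some layer, while equal side
  information is equal in both.\<close>

lemma code_length_add:
  assumes "finite A"
  shows "code_length K A (s + t) \<le> code_length K A s + code_length K A t"
proof -
  obtain F where F: "valid_code K A s (code_length K A s) F"
    using code_length_valid assms by blast
  obtain G where G: "valid_code K A t (code_length K A t) G"
    using code_length_valid assms by blast
  define a b where "a x = (\<lambda>i\<in>A. take s (x i))" and "b x = (\<lambda>i\<in>A. drop s (x i))"
    for x :: "'a \<Rightarrow> bool list"
  have a: "a x \<in> realizations A s" and b: "b x \<in> realizations A t"
    if "x \<in> realizations A (s + t)" for x
    using that by (auto simp: a_def b_def realizations_def words_def PiE_iff)
  have lF: "length (F x) = code_length K A s" if "x \<in> realizations A s" for x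
    using F that unfolding valid_code_def words_def by auto
  have lG: "length (G x) = code_length K A t" if "x \<in> realizations A t" for x
    using G that unfolding valid_code_def words_def by auto
  have c: "confusable K A (a x) (a y) \<or> confusable K A (b x) (b y)" if xy: "confusable K A x y" for x y
  proof -
    obtain r where r: "r \<in> A" "x r \<noteq> y r" "\<forall>j\<in>K r \<inter> A. x j = y j"
      using xy unfolding confusable_def by blast
    have "take s (x r) \<noteq> take s (y r) \<or> drop s (x r) \<noteq> drop s (y r)"
      using r(2) by (metis append_take_drop_id)
    then show ?thesis using r unfolding confusable_def a_def b_def by fastforce
  qed
  have "valid_code K A (s + t) (code_length K A s + code_length K A t) (\<lambda>x. F (a x) @ G (b x))"
    unfolding valid_code_def
  proof (intro conjI ballI impI)
    show "(\<lambda>x. F (a x) @ G (b x)) \<in> realizations A (s + t) \<rightarrow>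
        words (code_length K A s + code_length K A t)"
      using a b lF lG by (auto simp: words_def)
    fix x y assume xy: "x \<in> realizations A (s + t)" "y \<in> realizations A (s + t)"
      and "F (a x) @ G (b x) = F (a y) @ G (b y)"
    then have "F (a x) = F (a y)" "G (b x) = G (b y)"
      using a lF by auto
    with F G a b xy show "\<not> confusable K A x y"
      using c unfolding valid_code_def by blast
  qed
  then show ?thesis by (rule code_length_le)
qed

lemma code_length_mult:
  assumes "finite A" "k \<ge> 1"
  shows "code_length K A (k * t) \<le> k * code_length K A t"
  using assms(2)
proof (induction k rule: nat_induct_at_least)
  case (Suc k)
  then show ?case using code_length_add[OF assms(1), of K t "k * t"] by simp
qed simp

section \<open>Covering by independent sets\<close>

text \<open>Double counting of the pairs \<open>(u, g)\<close> with \<open>u \<in> T g\<close>: if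
  every \<open>g\<close> covered less than the average part of \<open>U\<close>, the two counts
  would disagree.\<close>

lemma ex_index_ge_average:
  fixes a :: nat and U :: "'x set" and T :: "'g \<Rightarrow> 'x set"
  assumes "finite I" "I \<noteq> {}" "finite U"
    and "\<And>u. u \<in> U \<Longrightarrow> card {g\<in>I. u \<in> T g} = a"
  shows "\<exists>g\<in>I. card U * a \<le> card I * card (U \<inter> T g)"
proof (rule ccontr)
  assume "\<not> ?thesis"
  then have "card I * card (U \<inter> T g) < card U * a" if "g \<in> I" for g
    using that by force
  then have "(\<Sum>g\<in>I. card I * card (U \<inter> T g)) < (\<Sum>g\<in>I. card U * a)"
    by (intro sum_strict_mono assms)
  also have "(\<Sum>g\<in>I. card I * card (U \<inter> T g)) = card I * (\<Sum>g\<in>I. card (U \<inter> T g))"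
    by (simp add: sum_distrib_left)
  also have "(\<Sum>g\<in>I. card (U \<inter> T g)) = (\<Sum>g\<in>I. card {u\<in>U. u \<in> T g})"
    by (intro sum.cong refl arg_cong[of _ _ card]) auto
  also have "\<dots> = (\<Sum>u\<in>U. card {g\<in>I. u \<in> T g})"
    by (rule sum_multicount_gen) (use assms in auto)
  also have "\<dots> = card U * a" using assms(4) by simp
  finally show False by simp
qed

text \<open>Every step adds a set that covers at least the average fraction
  \<open>a / card I\<close> of what is still uncovered, so the remainder shrinks
  geometrically.\<close>

lemma greedy_cover:
  fixes a :: nat and X :: "'x set" and T :: "'g \<Rightarrow> 'x set"
  assumes "finite I" "I \<noteq> {}" "finite X"
    and "\<And>u. u \<in> X \<Longrightarrow> card {g\<in>I. u \<in> T g} = a"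
    and "a \<le> card I"
  shows "\<exists>c :: nat \<Rightarrow> 'g. c ` {..<m} \<subseteq> I \<and>
    real (card (X - (\<Union>i<m. T (c i)))) \<le> real (card X) * (1 - real a / real (card I)) ^ m"
proof (induction m)
  case (Suc m)
  define q where "q = 1 - real a / real (card I)"
  have n: "card I > 0" using assms by (simp add: card_gt_0_iff)
  have q: "q \<ge> 0" using assms(5) n by (simp add: q_def field_simps)
  obtain c where c: "c ` {..<m} \<subseteq> I"
    "real (card (X - (\<Union>i<m. T (c i)))) \<le> real (card X) * q ^ m"
    using Suc unfolding q_def by blast
  define U where "U = X - (\<Union>i<m. T (c i))"
  have U: "finite U" "U \<subseteq> X" using assms(3) by (auto simp: U_def)
  obtain g where g: "g \<in> I" "card U * a \<le> card I * card (U \<inter> T g)"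
    using ex_index_ge_average[of I U T a] assms U by blast
  have "card (U - T g) + card (U \<inter> T g) = card U"
    using U(1) by (metis card_Un_disjoint Diff_disjoint Int_commute Int_Diff_disjoint
        Int_Diff_Un Un_commute finite_Diff finite_Int)
  then have "real (card (U - T g)) = real (card U) - real (card (U \<inter> T g))"
    by linarith
  also have "\<dots> \<le> real (card U) * q"
  proof -
    have "real (card U) * real a \<le> real (card I) * real (card (U \<inter> T g))"
      using g(2) by (metis of_nat_le_iff of_nat_mult)
    then show ?thesis using n by (simp add: q_def field_simps)
  qed
  also have "\<dots> \<le> (real (card X) * q ^ m) * q"
    using c(2) q unfolding U_def by (rule mult_right_mono)
  finally have le: "real (card (U - T g)) \<le> real (card X) * q ^ Suc m" by (simp add: mult_ac)
  have "X - (\<Union>i<Suc m. T ((c(m := g)) i)) = U - T g"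
    unfolding U_def by (auto simp: less_Suc_eq)
  moreover have "(c(m := g)) ` {..<Suc m} \<subseteq> I" using c(1) g(1) by (auto simp: less_Suc_eq)
  ultimately show ?case using le unfolding q_def by metis
qed simp

section \<open>Translates of independent sets\<close>

definition translate :: "'v set \<Rightarrow> ('v \<Rightarrow> bool list) \<Rightarrow> ('v \<Rightarrow> bool list) \<Rightarrow> 'v \<Rightarrow> bool list" where
  "translate A g x = (\<lambda>a\<in>A. xor (g a) (x a))"

lemma translate_in:
  "g \<in> realizations A t \<Longrightarrow> x \<in> realizations A t \<Longrightarrow> translate A g x \<in> realizations A t"
  by (auto simp: translate_def realizations_def words_def PiE_iff)

lemma translate_commute: "translate A g x = translate A x g"
  unfolding translate_def using xor_commute by metis

lemma translate_cancel:
  assumes "g \<in> realizations A t" "x \<in> realizations A t"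
  shows "translate A (translate A g x) x = g"
proof
  fix a
  show "translate A (translate A g x) x a = g a"
  proof (cases "a \<in> A")
    case True
    then show ?thesis
      using assms by (simp add: translate_def xor_xor_cancel length_realizations)
  next
    case False
    then show ?thesis using assms by (auto simp: translate_def realizations_def PiE_def extensional_def)
  qed
qed

text \<open>Confusability depends only on the coordinates in which two realizations agree, and
  adding the same word to both leaves these unchanged.\<close>

lemma indep_translate:
  assumes "indep K A t S" "g \<in> realizations A t"
  shows "indep K A t (translate A g ` S)"
proof -
  have "confusable K A x y"
    if "x \<in> S" "y \<in> S" "confusable K A (translate A g x) (translate A g y)" for x y
  proof -
    have "translate A g x a = translate A g y a \<longleftrightarrow> x a = y a" if "a \<in> A" for a
    proof -
      have "x \<in> realizations A t" "y \<in> realizations A t"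
        using assms(1) \<open>x \<in> S\<close> \<open>y \<in> S\<close> by (auto simp: indep_def)
      then have "length (x a) = t" "length (y a) = t" "length (g a) = t"
        using assms(2) that by (simp_all add: length_realizations)
      then show ?thesis using that by (simp add: translate_def xor_eq_iff)
    qed
    then show ?thesis using that(3) unfolding confusable_def by blast
  qed
  then show ?thesis
    using assms translate_in unfolding indep_def by blast
qed

text \<open>Since xor is an involution, \<open>g\<close> moves \<open>s\<close> to \<open>u\<close>
  exactly when \<open>g\<close> is the sum of \<open>u\<close> and \<open>s\<close>; hence these
  \<open>g\<close> correspond to the elements of \<open>S\<close>. This supplies the constant degree
  that \<open>greedy_cover\<close> demands.\<close>

lemma card_translates_containing:
  assumes "S \<subseteq> realizations A t" "u \<in> realizations A t"
  shows "card {g\<in>realizations A t. u \<in> translate A g ` S} = card S"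
proof -
  have "{g\<in>realizations A t. u \<in> translate A g ` S} = translate A u ` S"
  proof (intro equalityI subsetI)
    fix g assume "g \<in> {g\<in>realizations A t. u \<in> translate A g ` S}"
    then obtain s where s: "g \<in> realizations A t" "s \<in> S" "u = translate A g s" by blast
    then have "g = translate A u s" using translate_cancel[of g A t s] assms by auto
    then show "g \<in> translate A u ` S" using s by blast
  next
    fix g assume "g \<in> translate A u ` S"
    then obtain s where s: "s \<in> S" "g = translate A u s" by blast
    then have "u = translate A g s" "g \<in> realizations A t"
      using translate_cancel[of u A t s] translate_in[of u A t s] assms by auto
    then show "g \<in> {g\<in>realizations A t. u \<in> translate A g ` S}" using s by blast
  qed
  moreover have "inj_on (translate A u) S"
  proof (rule inj_on_inverseI)
    fix s assume "s \<in> S"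
    then show "translate A (translate A u s) u = s"
      using translate_cancel[of s A t u] assms by (auto simp: translate_commute[of A u s])
  qed
  ultimately show ?thesis by (simp add: card_image)
qed

text \<open>The codeword names one member of the cover that contains the realization; realizations
  with equal codewords then lie in a common independent set.\<close>

lemma valid_code_from_cover:
  fixes T :: "nat \<Rightarrow> ('v \<Rightarrow> bool list) set"
  assumes "\<And>i. i < 2 ^ p \<Longrightarrow> indep K A t (T i)"
    and "realizations A t \<subseteq> (\<Union>i<2 ^ p. T i)"
  shows "\<exists>F. valid_code K A t p F"
proof -
  obtain e where e: "bij_betw e {..<2 ^ p :: nat} (words p)"
    using finite_same_card_bij[of "{..<2 ^ p :: nat}" "words p"] by (auto simp: card_words)
  obtain f :: "('v \<Rightarrow> bool list) \<Rightarrow> nat" where f: "\<And>x. x \<in> realizations A t \<Longrightarrow> f x < 2 ^ p \<and> x \<in> T (f x)"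
    using assms(2) by (metis UN_E lessThan_iff subsetD)
  have "valid_code K A t p (\<lambda>x. e (f x))"
    unfolding valid_code_def
  proof (intro conjI ballI impI)
    show "(\<lambda>x. e (f x)) \<in> realizations A t \<rightarrow> words p"
      using e f by (auto simp: bij_betw_def)
    fix x y assume xy: "x \<in> realizations A t" "y \<in> realizations A t" "e (f x) = e (f y)"
    then have "f x = f y" using e f by (auto simp: bij_betw_def inj_on_def)
    then show "\<not> confusable K A x y"
      using f xy assms(1) unfolding indep_def by metis
  qed
  then show ?thesis by blast
qed

text \<open>Greedily choosing \<open>2 ^ p\<close> translates of \<open>S\<close> leaves fewer than
  one realization uncovered, hence none. The factor \<open>t * card A\<close> is the binary
  logarithm of the number of realizations, which is what the exponential decay has to beat.\<close>

lemma valid_code_from_indep: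
  assumes A: "finite A" and S: "indep K A t S"
    and p: "card (realizations A t) * (t * card A) < 2 ^ p * card S"
  shows "\<exists>F. valid_code K A t p F"
proof -
  let ?X = "realizations A t"
  define n where "n = card ?X"
  \<comment> \<open>The density of \<open>S\<close>, which is also the proportion of translates
    through any given realization.\<close>
  define q where "q = real (card S) / real n"
  have n: "n = 2 ^ (t * card A)" using A by (simp add: n_def card_realizations)
  have S': "S \<subseteq> ?X" using S by (simp add: indep_def)
  have Sn: "card S \<le> n" using S' A by (auto simp: n_def intro: card_mono)
  have ne: "?X \<noteq> {}" using n unfolding n_def by force
  obtain c :: "nat \<Rightarrow> 'a \<Rightarrow> bool list" where c: "c ` {..<2 ^ p} \<subseteq> ?X"
    "real (card (?X - (\<Union>i<2 ^ p. translate A (c i) ` S))) \<le> real n * (1 - q) ^ 2 ^ p"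
    using greedy_cover[of ?X ?X "\<lambda>g. translate A g ` S" "card S" "2 ^ p"]
      card_translates_containing[OF S'] Sn ne A unfolding n_def q_def by auto
  have q1: "q \<le> 1" using Sn n by (simp add: q_def)
  have "(1 - q) ^ 2 ^ p \<le> exp (- q) ^ 2 ^ p"
    using q1 exp_ge_add_one_self[of "- q"] by (intro power_mono) auto
  also have "\<dots> = exp (- (2 ^ p * q))"
    by (simp flip: exp_of_nat_mult)
  also have "\<dots> < exp (- real (t * card A))"
  proof -
    have "real (n * (t * card A)) < real (2 ^ p * card S)"
      using p unfolding n_def by (subst of_nat_less_iff)
    then have "real (t * card A) < 2 ^ p * q" using n by (simp add: q_def field_simps)
    then show ?thesis by simp
  qed
  also have "\<dots> = 1 / exp 1 ^ (t * card A)"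
    by (simp add: exp_minus exp_of_nat_mult[symmetric] inverse_eq_divide)
  \<comment> \<open>Base e is weakened to base 2 because the number of realizations is a power of
    2.\<close>
  also have "\<dots> \<le> 1 / 2 ^ (t * card A)"
    using exp_ge_add_one_self[of 1] by (intro divide_left_mono power_mono) auto
  also have "\<dots> = 1 / real n" by (simp add: n)
  finally have "real n * (1 - q) ^ 2 ^ p < 1" using n by (simp add: field_simps)
  with c(2) have "card (?X - (\<Union>i<2 ^ p. translate A (c i) ` S)) = 0" by linarith
  then have "?X \<subseteq> (\<Union>i<2 ^ p. translate A (c i) ` S)" using A by simp
  then show ?thesis
    using valid_code_from_cover[of p K A t "\<lambda>i. translate A (c i) ` S"] indep_translate[OF S] c(1)
    by blast
qed

text \<open>The covering bound must fail for a length one below the optimum; that missing bit is the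
  factor 2. At optimal length 0 there is no shorter length, and the estimate follows from
  \<open>card S \<le> card (realizations A t)\<close> because the extra factor is at least
  1.\<close>

lemma code_length_upper_indep:
  assumes A: "finite A" "A \<noteq> {}" and t: "t \<ge> 1" and S: "indep K A t S"
  shows "2 ^ code_length K A t * card S \<le> 2 * (t * card A) * card (realizations A t)"
proof (cases "code_length K A t")
  case 0
  have "card S \<le> card (realizations A t)"
    using S A by (auto simp: indep_def intro: card_mono)
  moreover have "1 \<le> 2 * (t * card A)" using A t by (simp add: Suc_le_eq card_gt_0_iff)
  ultimately have "1 * card S \<le> 2 * (t * card A) * card (realizations A t)"
    by (intro mult_le_mono)
  then show ?thesis using 0 by simp
next
  case (Suc p)
  have "\<not> card (realizations A t) * (t * card A) < 2 ^ p * card S"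
    using valid_code_from_indep[OF A(1) S, of p] code_length_le[of K A t p] Suc by fastforce
  then show ?thesis using Suc by (simp add: mult_ac)
qed

section \<open>Maximum independent sets and superadditivity\<close>

lemma max_indep_exists:
  assumes "finite A"
  obtains S where "indep K A t S" "\<And>T. indep K A t T \<Longrightarrow> card T \<le> card S"
proof -
  have "\<exists>S. indep K A t S \<and> (\<forall>T. indep K A t T \<longrightarrow> card T \<le> card S)"
  proof (rule Lattices_Big.ex_has_greatest_nat)
    show "indep K A t {}" by (simp add: indep_def)
    show "\<forall>T. indep K A t T \<longrightarrow> card T < Suc (card (realizations A t))"
      using assms by (auto simp: indep_def less_Suc_eq_le intro: card_mono)
  qed
  with that show thesis by blast
qed

text \<open>\<open>S\<close> is split into fibres over its projection to \<open>B\<close>: there are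
  at most \<open>b\<close> fibres, and each has at most \<open>a\<close> elements.\<close>

lemma card_indep_union_le:
  assumes "finite A" "finite B" "A \<inter> B = {}" "\<And>r. r \<in> B \<Longrightarrow> K r \<inter> A = {}"
    and S: "indep K (A \<union> B) t S"
    and a: "\<And>T. indep K A t T \<Longrightarrow> card T \<le> a"
    and b: "\<And>T. indep K B t T \<Longrightarrow> card T \<le> b"
  shows "card S \<le> a * b"
proof -
  have SX: "S \<subseteq> realizations (A \<union> B) t" using S by (simp add: indep_def)
  have Sc: "\<not> confusable K (A \<union> B) x y" if "x \<in> S" "y \<in> S" for x y
    using S that by (simp add: indep_def)
  let ?P = "(\<lambda>x. restrict x B) ` S"
  let ?Fib = "\<lambda>z. {x\<in>S. restrict x B = z}"
  have finS: "finite S" using SX assms by (meson finite_UnI finite_realizations finite_subset)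
  \<comment> \<open>Receivers in \<open>B\<close> have no side information in \<open>A\<close>, so a
    confusion between projections lifts to any preimages.\<close>
  have P: "indep K B t ?P"
  proof -
    have "confusable K (A \<union> B) x y"
      if c: "confusable K B (restrict x B) (restrict y B)" for x y :: "_ \<Rightarrow> bool list"
    proof -
      obtain r where "r \<in> B" "x r \<noteq> y r" "\<forall>j\<in>K r \<inter> B. x j = y j"
        using c unfolding confusable_def by auto
      moreover have "K r \<inter> (A \<union> B) = K r \<inter> B" using assms(4)[OF \<open>r \<in> B\<close>] by blast
      ultimately show ?thesis unfolding confusable_def by auto
    qed
    then show ?thesis using Sc SX restrict_realizations unfolding indep_def by blast
  qed
  have fib: "card (?Fib z) \<le> a" if "z \<in> ?P" for z
  proof -
    have inj: "inj_on (\<lambda>x. restrict x A) (?Fib z)"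
    proof (rule inj_onI)
      fix x y assume xy: "x \<in> ?Fib z" "y \<in> ?Fib z" "restrict x A = restrict y A"
      then have "x i = y i" if "i \<in> A \<union> B" for i
        using that restrict_eq_iff[of x A y] restrict_eq_iff[of x B y] by auto
      moreover have "x \<in> extensional (A \<union> B)" "y \<in> extensional (A \<union> B)"
        using xy SX by (auto simp: realizations_def PiE_def)
      ultimately show "x = y" by (meson extensionalityI)
    qed
    \<comment> \<open>Receivers in \<open>A\<close> may know messages of \<open>B\<close>, but these
      are constant on a fibre and distinguish nothing there.\<close>
    have "indep K A t ((\<lambda>x. restrict x A) ` ?Fib z)"
    proof -
      have "confusable K (A \<union> B) x y"
        if xy: "restrict x B = restrict y B"
          and c: "confusable K A (restrict x A) (restrict y A)" for x y :: "_ \<Rightarrow> bool list"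
      proof -
        have "\<forall>j\<in>B. x j = y j" using xy by (simp add: restrict_eq_iff)
        then show ?thesis using c unfolding confusable_def by auto
      qed
      then show ?thesis using Sc SX restrict_realizations unfolding indep_def by blast
    qed
    then have "card ((\<lambda>x. restrict x A) ` ?Fib z) \<le> a" by (rule a)
    then show ?thesis using inj by (simp add: card_image)
  qed
  have "S = (\<Union>z\<in>?P. ?Fib z)" by blast
  then have "card S \<le> (\<Sum>z\<in>?P. card (?Fib z))"
    using card_UN_le[of ?P ?Fib] finS by simp
  also have "\<dots> \<le> (\<Sum>z\<in>?P. a)" using fib by (intro sum_mono)
  also have "\<dots> = card ?P * a" by simp
  also have "\<dots> \<le> b * a" using b[OF P] by simp
  finally show ?thesis by (simp add: mult.commute)
qed

text \<open>The encoder partitions the realizations into at most \<open>2 ^ p\<close> fibres, each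
  of which is independent.\<close>

lemma card_realizations_le_code:
  assumes "finite A" "valid_code K A t p F" "\<And>S. indep K A t S \<Longrightarrow> card S \<le> c"
  shows "card (realizations A t) \<le> 2 ^ p * c"
proof -
  let ?X = "realizations A t"
  have F: "F \<in> ?X \<rightarrow> words p" using assms(2) by (simp add: valid_code_def)
  have "?X = (\<Union>w\<in>words p. {x\<in>?X. F x = w})" using F by auto
  then have "card ?X \<le> (\<Sum>w\<in>words p. card {x\<in>?X. F x = w})"
    using card_UN_le[of "words p" "\<lambda>w. {x\<in>?X. F x = w}"] by simp
  also have "\<dots> \<le> (\<Sum>w\<in>words p. c)"
    by (intro sum_mono assms(3)) (use assms(2) in \<open>auto simp: valid_code_def indep_def\<close>)
  also have "\<dots> = 2 ^ p * c" by (simp add: card_words)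
  finally show ?thesis .
qed

text \<open>The upper bounds for \<open>A\<close> and \<open>B\<close> are multiplied and compared
  with the lower bound for \<open>A \<union> B\<close>. The maximum independent set sizes appear as
  the same product on both sides and cancel, leaving a factor polynomial in
  \<open>t\<close>.\<close>

lemma code_length_superadd:
  assumes fin: "finite A" "finite B" and ne: "A \<noteq> {}" "B \<noteq> {}" and t: "t \<ge> 1"
    and dis: "A \<inter> B = {}" and K: "\<And>r. r \<in> B \<Longrightarrow> K r \<inter> A = {}"
  shows "2 ^ (code_length K A t + code_length K B t) \<le>
    2 ^ code_length K (A \<union> B) t * (2 * t * card (A \<union> B)) ^ 2"
proof -
  let ?X = "realizations"
  let ?l = "code_length K"
  obtain S where S: "indep K A t S" "\<And>T. indep K A t T \<Longrightarrow> card T \<le> card S"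
    using max_indep_exists fin(1) by blast
  obtain R where R: "indep K B t R" "\<And>T. indep K B t T \<Longrightarrow> card T \<le> card R"
    using max_indep_exists fin(2) by blast
  obtain F where F: "valid_code K (A \<union> B) t (?l (A \<union> B) t) F"
    using code_length_valid fin by (metis finite_UnI)
  have cX: "card (?X (A \<union> B) t) = card (?X A t) * card (?X B t)"
    using fin dis by (simp add: card_realizations card_Un_disjoint distrib_left power_add)
  have "card (?X (A \<union> B) t) \<le> 2 ^ ?l (A \<union> B) t * (card S * card R)"
    using fin by (intro card_realizations_le_code[OF _ F] card_indep_union_le[OF fin dis K _ S(2) R(2)]) auto
  then have X: "card (?X A t) * card (?X B t) \<le> 2 ^ ?l (A \<union> B) t * (card S * card R)"
    by (simp add: cX)
  \<comment> \<open>The number of realizations is a power of 2, so the product bounding it cannot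
    vanish; this permits the final cancellation.\<close>
  have pos: "card S * card R > 0"
    using X fin by (metis card_realizations mult_is_0 not_gr_zero le_zero_eq power_not_zero zero_neq_numeral)
  have "2 ^ (?l A t + ?l B t) * (card S * card R) = (2 ^ ?l A t * card S) * (2 ^ ?l B t * card R)"
    by (simp add: power_add)
  also have "\<dots> \<le> (2 * (t * card A) * card (?X A t)) * (2 * (t * card B) * card (?X B t))"
    by (intro mult_le_mono code_length_upper_indep fin ne t S R)
  also have "\<dots> = ((2 * t * card A) * (2 * t * card B)) * (card (?X A t) * card (?X B t))"
    by simp
  also have "\<dots> \<le> ((2 * t * card (A \<union> B)) * (2 * t * card (A \<union> B))) * (2 ^ ?l (A \<union> B) t * (card S * card R))"
    using fin by (intro mult_le_mono X order_refl card_mono) auto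
  also have "\<dots> = 2 ^ ?l (A \<union> B) t * (2 * t * card (A \<union> B)) ^ 2 * (card S * card R)"
    by (simp add: power2_eq_square)
  finally show ?thesis using pos by (simp only: mult_le_cancel2)
qed

section \<open>Two senders\<close>

definition two_sender_length :: "('v, 'e) pre_digraph \<Rightarrow> 'v set \<Rightarrow> 'v set \<Rightarrow> nat \<Rightarrow> nat" where
  "two_sender_length D M\<^sub>1 M\<^sub>2 t = (LEAST p. \<exists>p\<^sub>1 p\<^sub>2 F\<^sub>1 F\<^sub>2 G.
     p = p\<^sub>1 + p\<^sub>2 \<and> two_sender_index_code D M\<^sub>1 M\<^sub>2 t p\<^sub>1 p\<^sub>2 F\<^sub>1 F\<^sub>2 G)"

lemma beta_t_code_length:
  "wf_digraph D \<Longrightarrow> beta_t D t = real (code_length (out_nbrs D) (verts D) t) / real t"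
  by (simp add: beta_t_def code_length_def index_code_iff_valid_code)

lemma two_sender_beta_t_length:
  "two_sender_beta_t D M\<^sub>1 M\<^sub>2 t = real (two_sender_length D M\<^sub>1 M\<^sub>2 t) / real t"
  by (simp add: two_sender_beta_t_def two_sender_length_def)

text \<open>Both senders know part 3, so each can add its own piece of the codeword for part 3 to
  its private codeword. Receivers in parts 1 and 2 know part 3 and strip that piece off; receivers
  in part 3 know parts 1 and 2, strip those codewords off and reassemble both pieces.\<close>

lemma two_sender_code_merge:
  fixes M\<^sub>1 M\<^sub>2 :: "'v set" and t :: nat
  defines "A\<^sub>1 \<equiv> M\<^sub>1 - M\<^sub>2" and "A\<^sub>2 \<equiv> M\<^sub>2 - M\<^sub>1" and "A\<^sub>3 \<equiv> M\<^sub>1 \<inter> M\<^sub>2"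
  assumes wf: "wf_digraph D" and V: "M\<^sub>1 \<union> M\<^sub>2 = verts D" and fin: "finite (verts D)"
    and K1: "\<And>r. r \<in> A\<^sub>1 \<union> A\<^sub>2 \<Longrightarrow> A\<^sub>3 \<subseteq> out_nbrs D r"
    and K3: "\<And>r. r \<in> A\<^sub>3 \<Longrightarrow> A\<^sub>1 \<union> A\<^sub>2 \<subseteq> out_nbrs D r"
  defines "l \<equiv> \<lambda>A. code_length (out_nbrs D) A t"
  shows "\<exists>p\<^sub>1 p\<^sub>2 F\<^sub>1 F\<^sub>2 G. max (l A\<^sub>1 + l A\<^sub>2) (l A\<^sub>3) = p\<^sub>1 + p\<^sub>2 \<and>
    two_sender_index_code D M\<^sub>1 M\<^sub>2 t p\<^sub>1 p\<^sub>2 F\<^sub>1 F\<^sub>2 G"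
proof -
  let ?K = "out_nbrs D"
  let ?X = "\<lambda>A. realizations A t"
  \<comment> \<open>If part 3 needs the longer codeword, the first sender carries all of the excess;
    the second sends just \<open>l A\<^sub>2\<close> bits. The codes for parts 1 and 3 are padded to
    fit.\<close>
  define p where "p = max (l A\<^sub>1 + l A\<^sub>2) (l A\<^sub>3) - l A\<^sub>2"
  define q where "q = l A\<^sub>2"
  have sub: "A\<^sub>1 \<subseteq> M\<^sub>1" "A\<^sub>3 \<subseteq> M\<^sub>1" "A\<^sub>2 \<subseteq> M\<^sub>2" "A\<^sub>3 \<subseteq> M\<^sub>2"
    by (auto simp: A\<^sub>1_def A\<^sub>2_def A\<^sub>3_def)
  have Vs: "verts D = A\<^sub>1 \<union> A\<^sub>2 \<union> A\<^sub>3" using V by (auto simp: A\<^sub>1_def A\<^sub>2_def A\<^sub>3_def)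
  have le: "l A\<^sub>1 \<le> p" "l A\<^sub>3 \<le> p + q" "max (l A\<^sub>1 + l A\<^sub>2) (l A\<^sub>3) = p + q"
    by (auto simp: p_def q_def)
  have "finite A\<^sub>1" "finite A\<^sub>2" "finite A\<^sub>3" using fin Vs by auto
  then have ex: "\<exists>F. valid_code ?K A\<^sub>1 t (l A\<^sub>1) F" "\<exists>F. valid_code ?K A\<^sub>2 t q F"
      "\<exists>F. valid_code ?K A\<^sub>3 t (l A\<^sub>3) F"
    unfolding l_def q_def using code_length_valid by metis+
  then obtain f g h where f: "valid_code ?K A\<^sub>1 t p f" and g: "valid_code ?K A\<^sub>2 t q g"
      and h: "valid_code ?K A\<^sub>3 t (p + q) h"
    using valid_code_pad le by metis
  have lf: "length (f x) = p" if "x \<in> ?X A\<^sub>1" for x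
    using f that unfolding valid_code_def words_def by auto
  have lg: "length (g x) = q" if "x \<in> ?X A\<^sub>2" for x
    using g that unfolding valid_code_def words_def by auto
  have lh: "length (h x) = p + q" if "x \<in> ?X A\<^sub>3" for x
    using h that unfolding valid_code_def words_def by auto
  define F\<^sub>1 where "F\<^sub>1 x = xor (f (restrict x A\<^sub>1)) (take p (h (restrict x A\<^sub>3)))" for x
  define F\<^sub>2 where "F\<^sub>2 x = xor (g (restrict x A\<^sub>2)) (drop p (h (restrict x A\<^sub>3)))" for x
  have F1: "F\<^sub>1 \<in> ?X M\<^sub>1 \<rightarrow> words p"
    using restrict_realizations[OF _ sub(1)] restrict_realizations[OF _ sub(2)]
    by (auto simp: F\<^sub>1_def words_def lf lh)
  have F2: "F\<^sub>2 \<in> ?X M\<^sub>2 \<rightarrow> words q"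
    using restrict_realizations[OF _ sub(3)] restrict_realizations[OF _ sub(4)]
    by (auto simp: F\<^sub>2_def words_def lg lh)
  have main: "\<not> confusable ?K (verts D) x y"
    if x: "x \<in> ?X (verts D)" and y: "y \<in> ?X (verts D)"
      and e1: "F\<^sub>1 (restrict x M\<^sub>1) = F\<^sub>1 (restrict y M\<^sub>1)"
      and e2: "F\<^sub>2 (restrict x M\<^sub>2) = F\<^sub>2 (restrict y M\<^sub>2)" for x y
  proof
    assume "confusable ?K (verts D) x y"
    then obtain r where r: "r \<in> verts D" "x r \<noteq> y r" "\<And>j. j \<in> ?K r \<Longrightarrow> j \<in> verts D \<Longrightarrow> x j = y j"
      unfolding confusable_def by blast
    have subV: "A\<^sub>1 \<subseteq> verts D" "A\<^sub>2 \<subseteq> verts D" "A\<^sub>3 \<subseteq> verts D" using Vs by auto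
    let ?x1 = "restrict x A\<^sub>1" and ?x2 = "restrict x A\<^sub>2" and ?x3 = "restrict x A\<^sub>3"
    let ?y1 = "restrict y A\<^sub>1" and ?y2 = "restrict y A\<^sub>2" and ?y3 = "restrict y A\<^sub>3"
    note in_X = restrict_realizations[OF x subV(1)] restrict_realizations[OF x subV(2)]
      restrict_realizations[OF x subV(3)] restrict_realizations[OF y subV(1)]
      restrict_realizations[OF y subV(2)] restrict_realizations[OF y subV(3)]
    have rr: "restrict (restrict z M\<^sub>1) A\<^sub>1 = restrict z A\<^sub>1" "restrict (restrict z M\<^sub>1) A\<^sub>3 = restrict z A\<^sub>3"
      "restrict (restrict z M\<^sub>2) A\<^sub>2 = restrict z A\<^sub>2" "restrict (restrict z M\<^sub>2) A\<^sub>3 = restrict z A\<^sub>3"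
      for z :: "'v \<Rightarrow> bool list"
      using sub by (auto simp: restrict_restrict Int_absorb1)
    have E1: "xor (f ?x1) (take p (h ?x3)) = xor (f ?y1) (take p (h ?y3))"
      and E2: "xor (g ?x2) (drop p (h ?x3)) = xor (g ?y2) (drop p (h ?y3))"
      using e1 e2 unfolding F\<^sub>1_def F\<^sub>2_def rr by auto
    \<comment> \<open>The receiver confused in the whole problem remains confused inside its own
      part, where it has only less side information.\<close>
    have conf: "confusable ?K A (restrict x A) (restrict y A)" if "r \<in> A" "A \<subseteq> verts D" for A
      using that r unfolding confusable_def by auto
    consider "r \<in> A\<^sub>1" | "r \<in> A\<^sub>2" | "r \<in> A\<^sub>3" using r(1) Vs by blast
    then show False
    proof cases
      case 1
      then have "?x3 = ?y3" using K1[of r] r(3) subV unfolding restrict_eq_iff by blast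
      then have "xor (f ?x1) (take p (h ?x3)) = xor (f ?y1) (take p (h ?x3))" using E1 by simp
      then have "f ?x1 = f ?y1"
        by (rule xor_right_cancel[rotated 2]) (use in_X in \<open>simp_all add: lf lh\<close>)
      then show False using f in_X conf[OF 1 subV(1)] unfolding valid_code_def by blast
    next
      case 2
      then have "?x3 = ?y3" using K1[of r] r(3) subV unfolding restrict_eq_iff by blast
      then have "xor (g ?x2) (drop p (h ?x3)) = xor (g ?y2) (drop p (h ?x3))" using E2 by simp
      then have "g ?x2 = g ?y2"
        by (rule xor_right_cancel[rotated 2]) (use in_X in \<open>simp_all add: lg lh\<close>)
      then show False using g in_X conf[OF 2 subV(2)] unfolding valid_code_def by blast
    next
      case 3
      then have "?x1 = ?y1" "?x2 = ?y2" using K3[of r] r(3) subV unfolding restrict_eq_iff by blast+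
      then have "xor (f ?x1) (take p (h ?x3)) = xor (f ?x1) (take p (h ?y3))"
        and "xor (g ?x2) (drop p (h ?x3)) = xor (g ?x2) (drop p (h ?y3))"
        using E1 E2 by simp_all
      then have "take p (h ?x3) = take p (h ?y3)" "drop p (h ?x3) = drop p (h ?y3)"
        by (subst (asm) xor_eq_iff; use in_X in \<open>simp add: lf lg lh\<close>)+
      then have "h ?x3 = h ?y3" by (metis append_take_drop_id)
      then show False using h in_X conf[OF 3 subV(3)] unfolding valid_code_def by blast
    qed
  qed
  have "\<exists>G. two_sender_index_code D M\<^sub>1 M\<^sub>2 t p q F\<^sub>1 F\<^sub>2 G"
    unfolding two_sender_index_code_iff[OF wf V] using F1 F2 main by blast
  then show ?thesis unfolding le(3) by blast
qed

text \<open>A single sender can transmit both sub-codewords in a row; their fixed lengths make the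
  concatenation uniquely separable.\<close>

lemma two_sender_code_concat:
  assumes wf: "wf_digraph D" and V: "M\<^sub>1 \<union> M\<^sub>2 = verts D"
    and c: "two_sender_index_code D M\<^sub>1 M\<^sub>2 t p\<^sub>1 p\<^sub>2 F\<^sub>1 F\<^sub>2 G"
  shows "code_length (out_nbrs D) (verts D) t \<le> p\<^sub>1 + p\<^sub>2"
proof -
  have F: "F\<^sub>1 \<in> realizations M\<^sub>1 t \<rightarrow> words p\<^sub>1" "F\<^sub>2 \<in> realizations M\<^sub>2 t \<rightarrow> words p\<^sub>2"
    and d: "\<And>x y. x \<in> realizations (verts D) t \<Longrightarrow> y \<in> realizations (verts D) t \<Longrightarrow>
       F\<^sub>1 (restrict x M\<^sub>1) = F\<^sub>1 (restrict y M\<^sub>1) \<Longrightarrow> F\<^sub>2 (restrict x M\<^sub>2) = F\<^sub>2 (restrict y M\<^sub>2) \<Longrightarrow>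
       \<not> confusable (out_nbrs D) (verts D) x y"
    using c two_sender_index_code_iff[OF wf V] by blast+
  have in_M: "restrict x M\<^sub>1 \<in> realizations M\<^sub>1 t" "restrict x M\<^sub>2 \<in> realizations M\<^sub>2 t"
    if "x \<in> realizations (verts D) t" for x
    using that V by (auto intro: restrict_realizations)
  have "valid_code (out_nbrs D) (verts D) t (p\<^sub>1 + p\<^sub>2) (\<lambda>x. F\<^sub>1 (restrict x M\<^sub>1) @ F\<^sub>2 (restrict x M\<^sub>2))"
    unfolding valid_code_def
  proof (intro conjI ballI impI)
    show "(\<lambda>x. F\<^sub>1 (restrict x M\<^sub>1) @ F\<^sub>2 (restrict x M\<^sub>2)) \<in> realizations (verts D) t \<rightarrow> words (p\<^sub>1 + p\<^sub>2)"
      using length_code[OF F(1) in_M(1)] length_code[OF F(2) in_M(2)] by (simp add: words_def)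
  next
    fix x y assume x: "x \<in> realizations (verts D) t" and y: "y \<in> realizations (verts D) t"
      and "F\<^sub>1 (restrict x M\<^sub>1) @ F\<^sub>2 (restrict x M\<^sub>2) = F\<^sub>1 (restrict y M\<^sub>1) @ F\<^sub>2 (restrict y M\<^sub>2)"
    then show "\<not> confusable (out_nbrs D) (verts D) x y"
      using d[OF x y] length_code[OF F(1) in_M(1)[OF x]] length_code[OF F(1) in_M(1)[OF y]] by auto
  qed
  then show ?thesis by (rule code_length_le)
qed

text \<open>Logarithm of \<open>code_length_superadd\<close>, with \<open>A \<union> B\<close>
  enlarged to \<open>V\<close> by monotonicity. The disjunction in the hypothesis covers either
  direction in which arcs between \<open>A\<close> and \<open>B\<close> are absent.\<close>

lemma code_length_superadd_log:
  assumes fin: "finite V" and sub: "A \<subseteq> V" "B \<subseteq> V" and ne: "A \<noteq> {}" "B \<noteq> {}" and t: "t \<ge> 1"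
    and dis: "A \<inter> B = {}" and K: "(\<forall>r\<in>B. K r \<inter> A = {}) \<or> (\<forall>r\<in>A. K r \<inter> B = {})"
  shows "real (code_length K A t + code_length K B t) \<le>
    real (code_length K V t) + 2 * log 2 (2 * real t * real (card V))"
proof -
  let ?l = "\<lambda>A. code_length K A t"
  have finAB: "finite A" "finite B" using fin sub finite_subset by auto
  have n: "card V \<ge> 1" using ne sub fin by (metis card_gt_0_iff One_nat_def Suc_le_eq subset_empty)
  have "2 ^ (?l A + ?l B) \<le> 2 ^ ?l (A \<union> B) * (2 * t * card (A \<union> B)) ^ 2"
    using K
  proof
    assume "\<forall>r\<in>B. K r \<inter> A = {}"
    then show ?thesis using code_length_superadd[OF finAB ne t dis] by blast
  next
    assume "\<forall>r\<in>A. K r \<inter> B = {}"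
    then show ?thesis
      using code_length_superadd[OF finAB(2,1) ne(2,1) t, of K] dis
      by (simp add: Int_commute Un_commute add.commute)
  qed
  also have "\<dots> \<le> 2 ^ ?l V * (2 * t * card V) ^ 2"
    using sub fin by (intro mult_le_mono power_mono power_increasing code_length_subset card_mono) auto
  finally have "real (2 ^ (?l A + ?l B)) \<le> real (2 ^ ?l V * (2 * t * card V) ^ 2)"
    by (subst of_nat_le_iff)
  then have "2 ^ (?l A + ?l B) \<le> 2 ^ ?l V * (2 * real t * real (card V)) ^ 2" by simp
  then have "log 2 (2 ^ (?l A + ?l B)) \<le> log 2 (2 ^ ?l V * (2 * real t * real (card V)) ^ 2)"
    using n t by (subst log_le_cancel_iff) auto
  then show ?thesis using n t by (simp add: log_mult log_nat_power)
qed

theorem corollary2: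
  fixes N :: nat
    and D :: "(nat, 'e) pre_digraph"
    and M\<^sub>1 M\<^sub>2 :: "nat set"
  assumes "digraph D"
    and "verts D = {1..N}"
    and "M\<^sub>1 \<union> M\<^sub>2 = verts D"
    and "fully_participated D M\<^sub>1 M\<^sub>2"
    and "{(1, 3), (3, 1), (2, 3), (3, 2)} \<subseteq> arcs (interaction_digraph D M\<^sub>1 M\<^sub>2)"
    and "\<not> ((1, 2) \<in> arcs (interaction_digraph D M\<^sub>1 M\<^sub>2) \<and> (2, 1) \<in> arcs (interaction_digraph D M\<^sub>1 M\<^sub>2))"
  shows "two_sender_beta D M\<^sub>1 M\<^sub>2 = beta D"
proof (rule antisym)
  interpret digraph D by fact
  have wf: "wf_digraph D" ..
  note V = assms(3)
  have fin: "finite (verts D)" by simp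
  define A\<^sub>1 A\<^sub>2 A\<^sub>3 where "A\<^sub>1 = M\<^sub>1 - M\<^sub>2" and "A\<^sub>2 = M\<^sub>2 - M\<^sub>1" and "A\<^sub>3 = M\<^sub>1 \<inter> M\<^sub>2"
  let ?K = "out_nbrs D"
  let ?l = "code_length ?K"
  let ?m = "two_sender_length D M\<^sub>1 M\<^sub>2"
  have parts: "verts (sub_digraph D M\<^sub>1 M\<^sub>2 1) = A\<^sub>1" "verts (sub_digraph D M\<^sub>1 M\<^sub>2 2) = A\<^sub>2"
    "verts (sub_digraph D M\<^sub>1 M\<^sub>2 3) = A\<^sub>3"
    by (auto simp: sub_digraph_def message_part_def A\<^sub>1_def A\<^sub>2_def A\<^sub>3_def)
  have full: "\<And>i j u v. (i, j) \<in> arcs (interaction_digraph D M\<^sub>1 M\<^sub>2) \<Longrightarrow>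
      u \<in> verts (sub_digraph D M\<^sub>1 M\<^sub>2 i) \<Longrightarrow> v \<in> verts (sub_digraph D M\<^sub>1 M\<^sub>2 j) \<Longrightarrow> v \<in> ?K u"
    using assms(4) by (auto simp: fully_participated_def out_nbrs_def)
  have K1: "A\<^sub>3 \<subseteq> ?K r" if "r \<in> A\<^sub>1 \<union> A\<^sub>2" for r
    using that full[of 1 3 r] full[of 2 3 r] assms(5) parts by auto
  have K3: "A\<^sub>1 \<union> A\<^sub>2 \<subseteq> ?K r" if "r \<in> A\<^sub>3" for r
    using that full[of 3 1 r] full[of 3 2 r] assms(5) parts by auto
  have ne: "A\<^sub>1 \<noteq> {}" "A\<^sub>2 \<noteq> {}"
    using assms(5) parts by (auto simp: interaction_digraph_def)
  \<comment> \<open>One of the two arcs of the interaction digraph is missing, and a missing arc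
    excludes every arc of \<open>D\<close> between these parts in that direction.\<close>
  have K12: "(\<forall>r\<in>A\<^sub>2. ?K r \<inter> A\<^sub>1 = {}) \<or> (\<forall>r\<in>A\<^sub>1. ?K r \<inter> A\<^sub>2 = {})"
  proof (rule ccontr)
    assume "\<not> ?thesis"
    then have "(1, 2) \<in> arcs (interaction_digraph D M\<^sub>1 M\<^sub>2)" "(2, 1) \<in> arcs (interaction_digraph D M\<^sub>1 M\<^sub>2)"
      using parts unfolding interaction_digraph_def out_nbrs_def by auto
    then show False using assms(6) by simp
  qed
  have sub: "A\<^sub>1 \<subseteq> verts D" "A\<^sub>2 \<subseteq> verts D" "A\<^sub>3 \<subseteq> verts D"
    using V by (auto simp: A\<^sub>1_def A\<^sub>2_def A\<^sub>3_def)
  \<comment> \<open>The merged codes give the upper bound on \<open>?m t\<close> and also ensure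
    that the minimum defining it is attained.\<close>
  have ex: "\<exists>p\<^sub>1 p\<^sub>2 F\<^sub>1 F\<^sub>2 G. max (?l A\<^sub>1 t + ?l A\<^sub>2 t) (?l A\<^sub>3 t) = p\<^sub>1 + p\<^sub>2 \<and>
      two_sender_index_code D M\<^sub>1 M\<^sub>2 t p\<^sub>1 p\<^sub>2 F\<^sub>1 F\<^sub>2 G" for t
    by (rule two_sender_code_merge[OF wf V fin, folded A\<^sub>1_def A\<^sub>2_def A\<^sub>3_def]) (fact K1 K3)+
  have upper: "?m t \<le> max (?l A\<^sub>1 t + ?l A\<^sub>2 t) (?l A\<^sub>3 t)" for t
    unfolding two_sender_length_def by (rule Least_le) (rule ex)
  have lower: "?l (verts D) t \<le> ?m t" for t
  proof -
    let ?P = "\<lambda>p. \<exists>p\<^sub>1 p\<^sub>2 F\<^sub>1 F\<^sub>2 G. p = p\<^sub>1 + p\<^sub>2 \<and>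
      two_sender_index_code D M\<^sub>1 M\<^sub>2 t p\<^sub>1 p\<^sub>2 F\<^sub>1 F\<^sub>2 G"
    have "?P (?m t)"
      unfolding two_sender_length_def by (rule LeastI[of ?P, OF ex])
    then obtain p\<^sub>1 p\<^sub>2 F\<^sub>1 F\<^sub>2 G where "?m t = p\<^sub>1 + p\<^sub>2"
      "two_sender_index_code D M\<^sub>1 M\<^sub>2 t p\<^sub>1 p\<^sub>2 F\<^sub>1 F\<^sub>2 G" by blast
    then show ?thesis using two_sender_code_concat[OF wf V] by simp
  qed
  have bdd: "bdd_below ((\<lambda>t. beta_t D t) ` {1..})" "bdd_below ((\<lambda>t. two_sender_beta_t D M\<^sub>1 M\<^sub>2 t) ` {1..})"
    by (auto intro!: bdd_belowI2[of _ 0] simp: beta_t_def two_sender_beta_t_def)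
  show "beta D \<le> two_sender_beta D M\<^sub>1 M\<^sub>2"
    unfolding beta_def two_sender_beta_def
  proof (rule cINF_mono[OF _ bdd(1)])
    fix t :: nat assume "t \<in> {1..}"
    moreover have "beta_t D t \<le> two_sender_beta_t D M\<^sub>1 M\<^sub>2 t"
      using lower by (simp add: beta_t_code_length[OF wf] two_sender_beta_t_length divide_right_mono)
    ultimately show "\<exists>s\<in>{1..}. beta_t D s \<le> two_sender_beta_t D M\<^sub>1 M\<^sub>2 t" by blast
  qed simp
  show "two_sender_beta D M\<^sub>1 M\<^sub>2 \<le> beta D"
    unfolding beta_def
  proof (rule cINF_greatest)
    fix t :: nat assume "t \<in> {1..}"
    then have t: "t \<ge> 1" by simp
    define n where "n = card (verts D)"
    \<comment> \<open>The logarithmic loss of superadditivity at message length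
      \<open>k * t\<close>, per message bit.\<close>
    define err where "err k = 2 * log 2 (2 * (real k * real t) * real n) / (real k * real t)" for k
    have n: "n \<ge> 1" using ne(1) sub(1) fin unfolding n_def
      by (metis card_gt_0_iff One_nat_def Suc_le_eq subset_empty)
    \<comment> \<open>The loss need not be small at the given \<open>t\<close>, so the comparison is
      made at multiples \<open>k * t\<close>, where subadditivity keeps the single-sender rate at
      most \<open>beta_t D t\<close>.\<close>
    have bound: "two_sender_beta D M\<^sub>1 M\<^sub>2 \<le> beta_t D t + err k" if k: "k \<ge> 1" for k
    proof -
      have kt: "k * t \<ge> 1" using k t by simp
      have "two_sender_beta D M\<^sub>1 M\<^sub>2 \<le> two_sender_beta_t D M\<^sub>1 M\<^sub>2 (k * t)"
        unfolding two_sender_beta_def using kt by (intro cINF_lower bdd) auto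
      also have "\<dots> \<le> real (max (?l A\<^sub>1 (k * t) + ?l A\<^sub>2 (k * t)) (?l A\<^sub>3 (k * t))) / real (k * t)"
        unfolding two_sender_beta_t_length using upper by (intro divide_right_mono) (simp_all del: of_nat_max)
      also have "\<dots> \<le> (real (?l (verts D) (k * t)) + 2 * log 2 (2 * real (k * t) * real n)) / real (k * t)"
      proof (intro divide_right_mono)
        have "real (?l A\<^sub>1 (k * t) + ?l A\<^sub>2 (k * t)) \<le>
            real (?l (verts D) (k * t)) + 2 * log 2 (2 * real (k * t) * real n)"
          unfolding n_def
          by (rule code_length_superadd_log[OF fin sub(1,2) ne kt _ K12]) (auto simp: A\<^sub>1_def A\<^sub>2_def)
        moreover have "real (?l A\<^sub>3 (k * t)) \<le> real (?l (verts D) (k * t))"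
          using code_length_subset[OF fin sub(3)] by simp
        \<comment> \<open>Nonnegativity of the loss lets the same bound cover the branch of the
          maximum that belongs to part 3.\<close>
        moreover have "0 \<le> log 2 (2 * real (k * t) * real n)"
        proof -
          have "1 \<le> real (2 * (k * t) * n)" using k t n by (simp flip: of_nat_mult)
          then show ?thesis using k t n by (subst zero_le_log_cancel_iff) simp_all
        qed
        ultimately show "real (max (?l A\<^sub>1 (k * t) + ?l A\<^sub>2 (k * t)) (?l A\<^sub>3 (k * t))) \<le>
            real (?l (verts D) (k * t)) + 2 * log 2 (2 * real (k * t) * real n)"
          unfolding of_nat_max by linarith
      qed simp
      also have "\<dots> = real (?l (verts D) (k * t)) / real (k * t) + err k"
        by (simp add: err_def add_divide_distrib)
      finally have le: "two_sender_beta D M\<^sub>1 M\<^sub>2 \<le> \<dots>" .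
      have "real (?l (verts D) (k * t)) / real (k * t) \<le> real (k * ?l (verts D) t) / real (k * t)"
        using code_length_mult[OF fin k] by (intro divide_right_mono) (simp_all del: of_nat_mult)
      also have "\<dots> = beta_t D t" using k by (simp add: beta_t_code_length[OF wf])
      finally show ?thesis using le by simp
    qed
    have "err \<longlonglongrightarrow> 0"
    proof -
      have "real t > 0" "real n > 0" using t n by auto
      then show ?thesis unfolding err_def by real_asymp
    qed
    then have "(\<lambda>k. beta_t D t + err k) \<longlonglongrightarrow> beta_t D t + 0" by (intro tendsto_intros)
    then show "two_sender_beta D M\<^sub>1 M\<^sub>2 \<le> beta_t D t"
      using bound by (intro LIMSEQ_le_const[of _ "beta_t D t"] exI[of _ 1]) auto
  qed simp
qed

end
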